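(* If $X\in\mathcal{C}$ has rank $p$, then the face $\mathcal{F}_X$ has dimension bounded as $$\frac{p(p+1)}{2}-n\frac{d+1}{2}\ \le\ \dim\mathcal{F}_X\ \le\ \frac{p(p+1)}{2}-p\frac{d+1}{2}.$$ If $p$ is an integer multiple of $d$, the upper bound is attained for some $X\in\mathcal{C}$ of rank $p$.
   Context: Integers satisfy $m\ge 1$, $1\le d\le p\le n=md$. $\mathbb{S}^{k\times k}$ is the space of real symmetric $k\times k$ matrices. Matrices $M\in\mathbb{R}^{n\times n}$ are viewed as $m\times m$ block matrices with blocks $M_{ij}\in\mathbb{R}^{d\times d}$. Define $\mathcal{C}=\{X\in\mathbb{S}^{n\times n}: X\succeq 0,\ X_{ii}=I_d,\ i=1,\dots,m\}$. A face of $\mathcal{C}$ is a convex subset $\mathcal{F}\subseteq\mathcal{C}$ such that every closed line segment in $\mathcal{C}$ with a relative interior point in $\mathcal{F}$ has both endpoints in $\mathcal{F}$. For $X\in\mathcal{C}$, $\mathcal{F}_X$ is the unique face of $\mathcal{C}$ containing $X$ in its relative interior. Explicitly, if $X=YY^\top$ with $Y\in\mathbb{R}^{n\times p}$, $p=\operatorname{rank}(X)$, and $Y_1,\dots,Y_m\in\mathbb{R}^{d\times p}$ are the stacked slices of $Y$, then $\mathcal{F}_X=\{Y(I_p+A)Y^\top: A\in\mathbb{S}^{p\times p},\ Y_iAY_i^\top=0\ (i=1,\dots,m),\ I_p+A\succeq 0\}$, and $\dim\mathcal{F}_X=\dim\{A\in\mathbb{S}^{p\times p}: Y_iAY_i^\top=0,\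 i=1,\dots,m\}$. *)

theory Defs
  imports "HOL-Analysis.Analysis"
begin

text \<open>
  The index type \<open>'m \<times> 'd\<close> has \<open>n = m d\<close> elements, where \<open>m = CARD('m) \<ge> 1\<close> and
  \<open>d = CARD('d) \<ge> 1\<close>; row \<open>(i, a)\<close> is the \<open>a\<close>-th row of the \<open>i\<close>-th block row.
\<close>

definition block :: "real^('m::finite \<times> 'd::finite)^('m \<times> 'd) \<Rightarrow> 'm \<Rightarrow> 'm \<Rightarrow> real^'d^'d"
  where "block M i j = (\<chi> a b. M $ (i, a) $ (j, b))"

definition psd :: "real^'n^'n \<Rightarrow> bool"
  where "psd M \<longleftrightarrow> transpose M = M \<and> (\<forall>v. 0 \<le> v \<bullet> (M *v v))"

definition block_elliptope :: "(real^('m::finite \<times> 'd::finite)^('m \<times> 'd)) set"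
  where "block_elliptope = {X. psd X \<and> (\<forall>i. block X i i = mat 1)}"

definition face_at :: "'a::euclidean_space set \<Rightarrow> 'a \<Rightarrow> 'a set"
  where "face_at S x = (THE F. F face_of S \<and> x \<in> rel_interior F)"

text \<open>The description is proper for every point of a convex set.\<close>

lemma ex1_face_at:
  fixes S :: "'a::euclidean_space set"
  assumes "convex S" "x \<in> S"
  shows "\<exists>!F. F face_of S \<and> x \<in> rel_interior F"
proof -
  define F where "F = \<Inter>{T. T face_of S \<and> x \<in> T}"
  have ne: "{T. T face_of S \<and> x \<in> T} \<noteq> {}"
    using assms face_of_refl by blast
  then have F: "F face_of S" and xF: "x \<in> F"
    unfolding F_def by (auto intro!: face_of_Inter)
  have "convex F"
    using F face_of_imp_convex by blast
  have "x \<in> rel_interior F"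
  proof (rule ccontr)
    assume "x \<notin> rel_interior F"
    then obtain a where le: "\<And>y. y \<in> F \<Longrightarrow> a \<bullet> x \<le> a \<bullet> y"
      and less: "\<And>y. y \<in> rel_interior F \<Longrightarrow> a \<bullet> x < a \<bullet> y"
      using supporting_hyperplane_rel_boundary [OF \<open>convex F\<close> xF] by metis
    have "F \<inter> {y. a \<bullet> y = a \<bullet> x} face_of F"
      using le by (intro face_of_Int_supporting_hyperplane_ge \<open>convex F\<close>) auto
    then have "F \<inter> {y. a \<bullet> y = a \<bullet> x} face_of S"
      using F face_of_trans by blast
    with xF have "F \<subseteq> F \<inter> {y. a \<bullet> y = a \<bullet> x}"
      by (subst F_def) (rule Inter_lower, simp)
    moreover obtain c where c: "c \<in> rel_interior F"
      using xF \<open>convex F\<close> rel_interior_eq_empty by blast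
    ultimately have "a \<bullet> c = a \<bullet> x"
      using rel_interior_subset by blast
    with less [OF c] show False by simp
  qed
  then show ?thesis
    using F face_of_eq by blast
qed

lemma face_at_face_of:
  fixes S :: "'a::euclidean_space set"
  assumes "convex S" "x \<in> S"
  shows "face_at S x face_of S" and "x \<in> rel_interior (face_at S x)"
  using theI' [OF ex1_face_at [OF assms]] unfolding face_at_def by auto

lemma psd_add: "psd A \<Longrightarrow> psd B \<Longrightarrow> psd (A + B)"
  by (auto simp: psd_def matrix_vector_mult_add_rdistrib inner_add_right
        transpose_def vec_eq_iff)

lemma psd_scaleR: "psd A \<Longrightarrow> 0 \<le> c \<Longrightarrow> psd (c *\<^sub>R A)"
  by (auto simp: psd_def scaleR_matrix_vector_assoc [symmetric] transpose_def vec_eq_iff)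

lemma convex_block_elliptope: "convex block_elliptope"
proof (rule convexI)
  fix X Y :: "real^('m::finite \<times> 'd::finite)^('m \<times> 'd)" and u v :: real
  assume X: "X \<in> block_elliptope" and Y: "Y \<in> block_elliptope"
    and uv: "0 \<le> u" "0 \<le> v" "u + v = 1"
  have "block (u *\<^sub>R X + v *\<^sub>R Y) i i = u *\<^sub>R block X i i + v *\<^sub>R block Y i i" for i
    by (simp add: block_def vec_eq_iff)
  moreover have "u *\<^sub>R mat 1 + v *\<^sub>R mat 1 = (mat 1 :: real^'d^'d)"
    using uv by (simp flip: scaleR_add_left)
  ultimately show "u *\<^sub>R X + v *\<^sub>R Y \<in> block_elliptope"
    using X Y uv by (auto simp: block_elliptope_def intro: psd_add psd_scaleR)
qed

end

theory Submission
  imports Defs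
begin

text \<open>
  The face at \<open>X\<close> consists of the \<open>Z\<close> in the elliptope whose kernel contains that of \<open>X\<close>, so its
  dimension is that of the space of symmetric \<open>H\<close> with range in \<open>V = range X\<close> and vanishing
  diagonal blocks. Without the block condition this space has dimension \<open>p (p + 1) / 2\<close>. Each of the
  \<open>m\<close> diagonal blocks imposes at most \<open>d (d + 1) / 2\<close> conditions, which gives the lower bound.
  For the upper bound the blocks are imposed one at a time: if the \<open>k\<close>-th block cuts the space of
  vectors of \<open>V\<close> vanishing on the previous blocks down by \<open>r \<le> d\<close> dimensions, it imposes at least
  \<open>r (2 d - r + 1) / 2 \<ge> r (d + 1) / 2\<close> conditions, and these \<open>r\<close> add up to \<open>p\<close>.
  Equality holds when \<open>X\<close> is the Gram matrix of \<open>p / d\<close> mutually orthogonal blocks, some of them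
  repeated: repeated blocks impose no new condition.
\<close>

section \<open>Rank-nullity on a subspace and orthonormal bases adapted to a subspace\<close>

lemma linear_matrix_vector_left: "linear (\<lambda>A :: real^'n^'m. A *v v)"
  by (rule linearI) (simp_all add: matrix_vector_mult_add_rdistrib scaleR_matrix_vector_assoc)

lemma inner_symmetric_matrix_vector:
  fixes A :: "real^'n^'n"
  assumes "transpose A = A"
  shows "u \<bullet> (A *v w) = (A *v u) \<bullet> w"
  by (metis assms dot_lmul_matrix transpose_matrix_vector)

text \<open>On the orthogonal complement \<open>?T\<close> of the kernel within \<open>S\<close> the
  map is injective, and it has the same image there as on all of \<open>S\<close>. This turns each
  diagonal block constraint into an exact loss of dimension.\<close>

lemma dim_image_plus_dim_kernel:
  fixes f :: "'a::euclidean_space \<Rightarrow> 'b::euclidean_space"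
  assumes f: "linear f" and S: "subspace S"
  shows "dim (f ` S) + dim {x \<in> S. f x = 0} = dim S"
proof -
  let ?N = "{x \<in> S. f x = 0}"
  let ?T = "{y \<in> S. \<forall>x \<in> ?N. orthogonal x y}"
  interpret f: linear f by (fact f)
  have N: "subspace ?N"
    using S by (auto simp: subspace_def f.add f.scaleR f.zero)
  have T: "subspace ?T"
    using S by (auto simp: subspace_def orthogonal_def inner_add_right)
  have "f ` S \<subseteq> f ` ?T"
  proof
    fix y assume "y \<in> f ` S"
    then obtain x where x: "x \<in> S" "y = f x" by blast
    obtain u w where u: "u \<in> span ?N" and w: "\<And>v. v \<in> span ?N \<Longrightarrow> orthogonal w v" and xuw: "x = u + w"
      by (rule orthogonal_subspace_decomp_exists [of ?N x]) (rule that)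
    have uN: "u \<in> ?N" using u N by (metis span_eq_iff)
    then have "w \<in> S" using x xuw S by (metis (no_types, lifting) add_diff_cancel_left' mem_Collect_eq subspace_diff)
    moreover have "orthogonal v w" if "v \<in> ?N" for v
      using w [of v] that span_base orthogonal_commute by metis
    moreover have "f w = y" using uN x xuw by (simp add: f.add)
    ultimately show "y \<in> f ` ?T" by blast
  qed
  then have "f ` S = f ` ?T" by blast
  moreover have "inj_on f (span ?T)"
  proof (rule inj_onI)
    have span: "span ?T = ?T" using T by (simp only: span_eq_iff)
    fix x y assume x: "x \<in> span ?T" and y: "y \<in> span ?T" and eq: "f x = f y"
    have xy: "x - y \<in> ?T" by (rule subspace_diff [OF T x [unfolded span] y [unfolded span]])
    with eq have "x - y \<in> ?N" by (simp add: f.diff)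
    with xy have "orthogonal (x - y) (x - y)" by blast
    then show "x = y" by (simp add: orthogonal_self)
  qed
  then have "dim (f ` ?T) = dim ?T" by (rule dim_image_eq [OF f])
  ultimately show ?thesis
    using dim_subspace_orthogonal_to_vectors [OF N S] by auto
qed

text \<open>An orthonormal basis of \<open>R\<close> is followed by one of the orthogonal complement
  of \<open>R\<close> in \<open>V\<close>. Indexing by naturals orders the basis, so that unordered
  pairs of basis vectors can be counted as pairs \<open>i \<le> j\<close>.\<close>

lemma orthonormal_sequence_extending:
  fixes R V :: "'a::euclidean_space set"
  assumes R: "subspace R" and V: "subspace V" and "R \<subseteq> V"
  obtains e :: "nat \<Rightarrow> 'a"
  where "\<And>i j. i < dim V \<Longrightarrow> j < dim V \<Longrightarrow> e i \<bullet> e j = (if i = j then 1 else 0)"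
    and "\<And>i. i < dim R \<Longrightarrow> e i \<in> R" and "\<And>i. i < dim V \<Longrightarrow> e i \<in> V"
    and "\<And>v. v \<in> V \<Longrightarrow> v = (\<Sum>i<dim V. (v \<bullet> e i) *\<^sub>R e i)"
proof -
  define T where "T = {y \<in> V. \<forall>x \<in> R. orthogonal x y}"
  have T: "subspace T"
    using V by (auto simp: T_def subspace_def orthogonal_def inner_add_right)
  have dims: "dim T + dim R = dim V"
    unfolding T_def by (rule dim_subspace_orthogonal_to_vectors [OF assms])
  obtain B where B: "B \<subseteq> R" "pairwise orthogonal B" "\<And>x. x \<in> B \<Longrightarrow> norm x = 1"
    "independent B" "card B = dim R" "span B = R"
    using orthonormal_basis_subspace [OF R] by metis
  obtain C where C: "C \<subseteq> T" "pairwise orthogonal C" "\<And>x. x \<in> C \<Longrightarrow> norm x = 1"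
    "independent C" "card C = dim T" "span C = T"
    using orthonormal_basis_subspace [OF T] by metis
  have fin: "finite B" "finite C"
    using B C independent_imp_finite by blast+
  obtain xs where xs: "set xs = B" "distinct xs" using finite_distinct_list fin by metis
  obtain ys where ys: "set ys = C" "distinct ys" using finite_distinct_list fin by metis
  have lens: "length xs = dim R" "length ys = dim T"
    using xs ys B C by (metis distinct_card)+
  have orthBC: "b \<bullet> c = 0" if "b \<in> B" "c \<in> C" for b c
    using that B C by (auto simp: T_def orthogonal_def)
  have disj: "B \<inter> C = {}"
    using orthBC B(3) by (metis disjoint_iff inner_eq_zero_iff norm_zero zero_neq_one)
  let ?zs = "xs @ ys"
  have len: "length ?zs = dim V" using lens dims by simp
  have dz: "distinct ?zs" using xs ys disj by simp
  have sz: "set ?zs = B \<union> C" using xs ys by simp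
  have on: "x \<bullet> y = (if x = y then 1 else 0)" if "x \<in> B \<union> C" "y \<in> B \<union> C" for x y
    using that B(2,3) C(2,3) orthBC disj
    using inner_commute [of x y] by (auto simp: pairwise_def orthogonal_def norm_eq_1)
  have BCV: "B \<union> C \<subseteq> V" using B C \<open>R \<subseteq> V\<close> by (auto simp: T_def)
  show ?thesis
  proof
    show "?zs ! i \<bullet> ?zs ! j = (if i = j then 1 else 0)" if "i < dim V" "j < dim V" for i j
      using on nth_mem [of _ ?zs] sz len that dz by (metis nth_eq_iff_index_eq)
    show "?zs ! i \<in> R" if "i < dim R" for i
      using that lens xs B(1) by (auto simp: nth_append)
    show "?zs ! i \<in> V" if "i < dim V" for i
      using that len sz BCV nth_mem by (metis subsetD)
    fix v assume v: "v \<in> V"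
    have "V \<subseteq> span (B \<union> C)"
    proof -
      have "independent (B \<union> C)"
        using on by (intro pairwise_orthogonal_independent) (force simp: pairwise_def orthogonal_def)+
      moreover have "card (B \<union> C) = dim V"
        using B C dims fin disj by (simp add: card_Un_disjoint)
      ultimately show ?thesis using BCV card_ge_dim_independent by (metis order_refl)
    qed
    then have "(\<Sum>b\<in>B \<union> C. (v \<bullet> b) *\<^sub>R b) = v"
      using v fin on by (intro orthonormal_basis_expand) (auto simp: pairwise_def orthogonal_def norm_eq_1)
    moreover have "bij_betw (\<lambda>i. ?zs ! i) {..<dim V} (B \<union> C)"
      using bij_betw_nth [OF dz] len sz by metis
    ultimately show "v = (\<Sum>i<dim V. (v \<bullet> ?zs ! i) *\<^sub>R ?zs ! i)"
      using sum.reindex_bij_betw [of "\<lambda>i. ?zs ! i" "{..<dim V}" "B \<union> C" "\<lambda>b. (v \<bullet> b) *\<^sub>R b"] by simp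
  qed
qed

section \<open>Symmetric matrices with range in a subspace\<close>

text \<open>This is x y^T + y x^T without normalisation, so \<open>symprod x x\<close> is twice the
  rank-one matrix x x^T.\<close>

definition symprod :: "real^'n \<Rightarrow> real^'n \<Rightarrow> real^'n^'n"
  where "symprod x y = (\<chi> i j. x $ i * y $ j + y $ i * x $ j)"

lemma symprod_commute: "symprod x y = symprod y x"
  by (simp add: symprod_def add.commute)

lemma transpose_symprod [simp]: "transpose (symprod x y) = symprod x y"
  by (simp add: symprod_def transpose_def vec_eq_iff algebra_simps)

lemma symprod_vector: "symprod x y *v v = (y \<bullet> v) *\<^sub>R x + (x \<bullet> v) *\<^sub>R y"
  by (simp add: symprod_def matrix_vector_mult_def inner_vec_def vec_eq_iff
      algebra_simps sum.distrib sum_distrib_left sum_distrib_right)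

text \<open>For an orthonormal family this makes the products over pairs \<open>i \<le> j\<close>
  nonzero and pairwise orthogonal, hence linearly independent.\<close>

lemma inner_symprod:
  "symprod x y \<bullet> symprod u w = 2 * ((x \<bullet> u) * (y \<bullet> w) + (x \<bullet> w) * (y \<bullet> u))"
proof -
  have prod: "(\<Sum>i\<in>UNIV. \<Sum>j\<in>UNIV. (a $ i * b $ i) * (c $ j * d $ j)) = (a \<bullet> b) * (c \<bullet> d)"
    for a b c d :: "real^'n"
    by (simp add: inner_vec_def sum_product)
  have "symprod x y \<bullet> symprod u w = (\<Sum>i\<in>UNIV. \<Sum>j\<in>UNIV.
      (x $ i * u $ i) * (y $ j * w $ j) + (x $ i * w $ i) * (y $ j * u $ j)
      + (y $ i * u $ i) * (x $ j * w $ j) + (y $ i * w $ i) * (x $ j * u $ j))"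
    unfolding inner_vec_def symprod_def by (simp add: algebra_simps)
  also have "\<dots> = (x \<bullet> u) * (y \<bullet> w) + (x \<bullet> w) * (y \<bullet> u) + (y \<bullet> u) * (x \<bullet> w) + (y \<bullet> w) * (x \<bullet> u)"
    by (simp add: sum.distrib prod)
  finally show ?thesis by (simp add: algebra_simps)
qed

text \<open>The trapezoid of pairs has r q - r (r - 1) / 2 elements; the form given avoids
  subtraction and division of naturals.\<close>

lemma card_triangle: "2 * card (SIGMA i:{..<r}. {i..<q}) + r * r = r * (2 * q + 1)" if "r \<le> q"
  using that
proof (induction r)
  case (Suc r)
  have "(SIGMA i:{..<Suc r}. {i..<q}) = (SIGMA i:{..<r}. {i..<q}) \<union> {r} \<times> {r..<q}"
    by (auto simp: less_Suc_eq)
  moreover have "card \<dots> = card (SIGMA i:{..<r}. {i..<q}) + (q - r)"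
    by (subst card_Un_disjoint) (auto simp: card_cartesian_product)
  moreover obtain s where "q = Suc r + s" using Suc.prems le_Suc_ex by blast
  ultimately show ?case using Suc by (simp add: algebra_simps)
qed simp

text \<open>Take an orthonormal basis of \<open>V\<close> that starts with one of \<open>R\<close>.
  The products of \<open>e i\<close> and \<open>e j\<close> with \<open>i < dim R\<close> and
  \<open>i \<le> j\<close> all lie in \<open>T\<close> and are independent. With
  \<open>R = V\<close> this counts symmetric matrices; with \<open>V\<close> the whole space it
  counts the conditions imposed by one block.\<close>

lemma dim_ge_symprods:
  fixes T :: "(real^'n^'n) set"
  assumes R: "subspace R" and V: "subspace V" and "R \<subseteq> V"
    and T: "\<And>x y. x \<in> R \<Longrightarrow> y \<in> V \<Longrightarrow> symprod x y \<in> T"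
  shows "dim R * (2 * dim V + 1) \<le> 2 * dim T + dim R * dim R"
proof -
  obtain e where on: "\<And>i j. i < dim V \<Longrightarrow> j < dim V \<Longrightarrow> e i \<bullet> e j = (if i = j then 1 else 0)"
    and eR: "\<And>i. i < dim R \<Longrightarrow> e i \<in> R" and eV: "\<And>i. i < dim V \<Longrightarrow> e i \<in> V"
    using orthonormal_sequence_extending [OF R V \<open>R \<subseteq> V\<close>] by metis
  have rq: "dim R \<le> dim V" using \<open>R \<subseteq> V\<close> by (rule dim_subset)
  let ?P = "SIGMA i:{..<dim R}. {i..<dim V}"
  let ?g = "\<lambda>(i, j). symprod (e i) (e j)"
  have inner: "?g s \<bullet> ?g t = 0" if "s \<in> ?P" "t \<in> ?P" "s \<noteq> t" for s t
    using that rq by (auto simp: inner_symprod on split: if_splits)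
  have nz: "?g s \<bullet> ?g s \<noteq> 0" if "s \<in> ?P" for s
    using that rq by (auto simp: inner_symprod on simp del: inner_eq_zero_iff split: if_splits)
  have inj: "inj_on ?g ?P"
    using inner nz by (metis (no_types, lifting) inj_onI)
  have "independent (?g ` ?P)"
  proof (rule pairwise_orthogonal_independent)
    show "pairwise orthogonal (?g ` ?P)"
      unfolding pairwise_image
      by (rule pairwiseI) (simp only: orthogonal_def inner simp_thms)
    show "0 \<notin> ?g ` ?P"
    proof
      assume "0 \<in> ?g ` ?P"
      then obtain s where "s \<in> ?P" "0 = ?g s" by (rule imageE)
      with nz [of s] show False by simp
    qed
  qed
  then have "dim (?g ` ?P) = card ?P"
    using card_image [OF inj] by (simp add: dim_eq_card_independent)
  moreover have "?g ` ?P \<subseteq> T"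
    using T eR eV by auto
  ultimately have "card ?P \<le> dim T"
    by (metis dim_subset)
  with card_triangle [OF rq] show ?thesis by linarith
qed

text \<open>When \<open>V\<close> is the range of X = Y Y^T, these are the matrices Y A Y^T with A
  symmetric, described without choosing a factor Y.\<close>

definition sym_on :: "(real^'n) set \<Rightarrow> (real^'n^'n) set"
  where "sym_on V = {H. transpose H = H \<and> (\<forall>v. H *v v \<in> V)}"

lemma subspace_sym_on:
  assumes "subspace V"
  shows "subspace (sym_on V)"
proof (rule subspaceI)
  show "0 \<in> sym_on V"
    using assms by (simp add: sym_on_def subspace_0 transpose_def vec_eq_iff)
  fix A B assume "A \<in> sym_on V" and "B \<in> sym_on V"
  then show "A + B \<in> sym_on V"
    using assms by (simp add: sym_on_def matrix_vector_mult_add_rdistrib subspace_add transpose_def vec_eq_iff)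
next
  fix c :: real and A assume A: "A \<in> sym_on V"
  then have "(c *\<^sub>R A) *v v \<in> V" for v
    using assms by (simp add: sym_on_def subspace_scale scaleR_matrix_vector_assoc [symmetric])
  with A show "c *\<^sub>R A \<in> sym_on V"
    by (simp add: sym_on_def transpose_def vec_eq_iff)
qed

lemma symprod_in_sym_on: "subspace V \<Longrightarrow> x \<in> V \<Longrightarrow> y \<in> V \<Longrightarrow> symprod x y \<in> sym_on V"
  by (simp add: sym_on_def symprod_vector subspace_add subspace_scale)

lemma dim_sym_on:
  fixes V :: "(real^'n) set"
  assumes V: "subspace V"
  shows "2 * dim (sym_on V) = dim V * (dim V + 1)"
proof (rule antisym)
  obtain e where "\<And>i j. i < dim V \<Longrightarrow> j < dim V \<Longrightarrow> e i \<bullet> e j = (if i = j then 1 else 0)"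
    and "\<And>i. i < dim V \<Longrightarrow> e i \<in> V" and "\<And>i. i < dim V \<Longrightarrow> e i \<in> V"
    and exp: "\<And>v. v \<in> V \<Longrightarrow> v = (\<Sum>i<dim V. (v \<bullet> e i) *\<^sub>R e i)"
    by (rule orthonormal_sequence_extending [OF V V subset_refl]) (rule that)
  let ?P = "SIGMA i:{..<dim V}. {i..<dim V}"
  let ?W = "(\<lambda>(i, j). symprod (e i) (e j)) ` ?P"
  have "sym_on V \<subseteq> span ?W"
  proof
    fix H assume "H \<in> sym_on V"
    then have tr: "transpose H = H" and HV: "\<And>v. H *v v \<in> V" by (auto simp: sym_on_def)
    define h where "h i j = e i \<bullet> (H *v e j)" for i j
    have hsym: "h i j = h j i" for i j
      unfolding h_def by (metis inner_symmetric_matrix_vector [OF tr] inner_commute)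
    \<comment> \<open>The double sum meets each product of two different basis vectors twice, and
      \<open>symprod (e i) (e i)\<close> is twice a rank-one matrix; both are compensated by the
      factor 1/2.\<close>
    define S where "S = (\<Sum>i<dim V. \<Sum>j<dim V. (h i j / 2) *\<^sub>R symprod (e i) (e j))"
    have "H *v v = S *v v" for v
    proof -
      have "H *v v = (\<Sum>i<dim V. ((H *v v) \<bullet> e i) *\<^sub>R e i)" by (rule exp [OF HV])
      also have "\<dots> = (\<Sum>i<dim V. ((H *v e i) \<bullet> v) *\<^sub>R e i)"
        by (metis (no_types) inner_symmetric_matrix_vector [OF tr] inner_commute)
      also have "\<dots> = (\<Sum>i<dim V. (\<Sum>j<dim V. h i j * (e j \<bullet> v)) *\<^sub>R e i)"
      proof (intro sum.cong refl)
        fix i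
        have "(H *v e i) \<bullet> v = (\<Sum>j<dim V. ((H *v e i) \<bullet> e j) *\<^sub>R e j) \<bullet> v"
          using exp [OF HV] by metis
        also have "\<dots> = (\<Sum>j<dim V. h i j * (e j \<bullet> v))"
          by (simp add: h_def inner_sum_left inner_symmetric_matrix_vector [OF tr])
        finally show "((H *v e i) \<bullet> v) *\<^sub>R e i = (\<Sum>j<dim V. h i j * (e j \<bullet> v)) *\<^sub>R e i" by simp
      qed
      finally have 1: "H *v v = (\<Sum>i<dim V. \<Sum>j<dim V. (h i j * (e j \<bullet> v)) *\<^sub>R e i)"
        by (simp add: scaleR_sum_left)
      \<comment> \<open>Exchanging the summations and using \<open>hsym\<close> gives a second form
        of the same vector; \<open>S *v v\<close> is the average of the two forms.\<close>
      then have 2: "H *v v = (\<Sum>i<dim V. \<Sum>j<dim V. (h i j * (e i \<bullet> v)) *\<^sub>R e j)"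
        by (subst sum.swap) (simp add: hsym)
      have "S *v v = (\<Sum>i<dim V. \<Sum>j<dim V. (h i j / 2) *\<^sub>R (symprod (e i) (e j) *v v))"
        unfolding S_def
        by (simp add: linear_sum [OF linear_matrix_vector_left] scaleR_matrix_vector_assoc)
      also have "\<dots> = (1/2) *\<^sub>R (\<Sum>i<dim V. \<Sum>j<dim V. (h i j * (e j \<bullet> v)) *\<^sub>R e i)
          + (1/2) *\<^sub>R (\<Sum>i<dim V. \<Sum>j<dim V. (h i j * (e i \<bullet> v)) *\<^sub>R e j)"
        by (simp add: symprod_vector scaleR_sum_right sum.distrib scaleR_add_right)
      also have "\<dots> = H *v v"
        unfolding 1 [symmetric] 2 [symmetric] by (simp flip: scaleR_add_left)
      finally show ?thesis by simp
    qed
    then have "H = S" by (simp add: matrix_eq)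
    moreover have "symprod (e i) (e j) \<in> ?W" if "i < dim V" "j < dim V" for i j
    proof (cases "i \<le> j")
      case True then show ?thesis using that by force
    next
      case False then show ?thesis using that by (subst symprod_commute) force
    qed
    ultimately show "H \<in> span ?W"
      unfolding S_def by (simp only:) (intro span_sum span_scale span_base; simp)
  qed
  then have "dim (sym_on V) \<le> card ?W"
    by (intro dim_le_card) auto
  also have "\<dots> \<le> card ?P" by (intro card_image_le) auto
  finally show "2 * dim (sym_on V) \<le> dim V * (dim V + 1)"
    using card_triangle [of "dim V" "dim V"] by (simp add: algebra_simps)
  show "dim V * (dim V + 1) \<le> 2 * dim (sym_on V)"
    using dim_ge_symprods [OF V V subset_refl symprod_in_sym_on [OF V]] by (simp add: algebra_simps)
qed

section \<open>Perturbation of positive semidefinite matrices\<close>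

text \<open>If w = A v were nonzero, a small step from v along -w would make the quadratic form
  negative: its first-order change is -2 s |w|^2, since the form vanishes at v.\<close>

lemma psd_kernel:
  assumes A: "psd A" and v: "v \<bullet> (A *v v) = 0"
  shows "A *v v = 0"
proof (rule ccontr)
  define w where "w = A *v v"
  \<comment> \<open>Small enough for the second-order term to be at most s |w|^2; the summand 1
    keeps the denominator positive.\<close>
  define s where "s = (w \<bullet> w) / (1 + \<bar>w \<bullet> (A *v w)\<bar>)"
  assume "A *v v \<noteq> 0"
  then have pos: "w \<bullet> w > 0" by (simp add: w_def)
  then have s: "s > 0" by (simp add: s_def)
  have tr: "transpose A = A" using A by (simp add: psd_def)
  have "0 \<le> (v - s *\<^sub>R w) \<bullet> (A *v (v - s *\<^sub>R w))"
    using A by (simp add: psd_def)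
  also have "\<dots> = s * (s * (w \<bullet> (A *v w)) - 2 * (w \<bullet> w))"
    using v inner_symmetric_matrix_vector [OF tr, of v w]
    by (simp add: matrix_vector_mult_diff_distrib matrix_vector_mult_scaleR
        inner_diff_left inner_diff_right algebra_simps flip: w_def)
  finally have "2 * (w \<bullet> w) \<le> s * (w \<bullet> (A *v w))"
    using s by (simp add: zero_le_mult_iff)
  also have "\<dots> \<le> s * (1 + \<bar>w \<bullet> (A *v w)\<bar>)"
    using s by (intro mult_left_mono) auto
  also have "\<dots> = w \<bullet> w" by (simp add: s_def)
  finally show False using pos by simp
qed

lemma subspace_range_matrix: "subspace (range ((*v) A))" for A :: "real^'n^'m"
  by (intro linear_subspace_image matrix_vector_mul_linear subspace_UNIV)

text \<open>The component z orthogonal to the range satisfies |A z|^2 = z . A (A z) = 0 by symmetry,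
  so it lies in the kernel.\<close>

lemma symmetric_range_kernel_decomp:
  fixes A :: "real^'n^'n"
  assumes "transpose A = A"
  obtains y z where "y \<in> range ((*v) A)" "A *v z = 0" "v = y + z"
proof -
  obtain y z where y: "y \<in> span (range ((*v) A))"
    and z: "\<And>w. w \<in> span (range ((*v) A)) \<Longrightarrow> orthogonal z w" and v: "v = y + z"
    by (rule orthogonal_subspace_decomp_exists [of "range ((*v) A)" v]) (rule that)
  have "y \<in> range ((*v) A)"
    using y subspace_range_matrix [of A] span_eq_iff by blast
  moreover have "z \<bullet> (A *v (A *v z)) = 0"
    using z [of "A *v (A *v z)"] by (simp add: orthogonal_def span_base)
  then have "A *v z = 0"
    using inner_symmetric_matrix_vector [OF assms, of z "A *v z"] by simp
  ultimately show ?thesis using v by (rule that)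
qed

lemma symmetric_range_kernel_orthogonal:
  fixes A :: "real^'n^'n"
  assumes "transpose A = A" "y \<in> range ((*v) A)" "A *v z = 0"
  shows "y \<bullet> z = 0"
  using assms inner_symmetric_matrix_vector [OF assms(1)] by (metis imageE inner_zero_right)

text \<open>Range and kernel of a symmetric matrix are orthogonal complements, so inclusion of
  ranges reverses to inclusion of kernels. The range side serves the dimension counts, the kernel
  side the description of the face.\<close>

lemma sym_on_range_iff:
  fixes A H :: "real^'n^'n"
  assumes A: "transpose A = A" and H: "transpose H = H"
  shows "H \<in> sym_on (range ((*v) A)) \<longleftrightarrow> (\<forall>z. A *v z = 0 \<longrightarrow> H *v z = 0)"
proof
  assume R: "H \<in> sym_on (range ((*v) A))"
  show "\<forall>z. A *v z = 0 \<longrightarrow> H *v z = 0"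
  proof (intro allI impI)
    fix z assume z: "A *v z = 0"
    have "H *v (H *v z) \<in> range ((*v) A)"
      using R by (simp add: sym_on_def)
    then have "(H *v (H *v z)) \<bullet> z = 0"
      using symmetric_range_kernel_orthogonal A z by blast
    then show "H *v z = 0"
      using inner_symmetric_matrix_vector [OF H, of z "H *v z"] by (simp add: inner_commute)
  qed
next
  assume ker: "\<forall>z. A *v z = 0 \<longrightarrow> H *v z = 0"
  have "H *v v \<in> range ((*v) A)" for v
  proof -
    obtain y z where y: "y \<in> range ((*v) A)" and z: "A *v z = 0" and eq: "H *v v = y + z"
      by (rule symmetric_range_kernel_decomp [OF A]) (rule that)
    have "z \<bullet> (y + z) = (H *v z) \<bullet> v"
      unfolding eq [symmetric] by (rule inner_symmetric_matrix_vector [OF H])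
    also have "\<dots> = 0" using ker z by simp
    finally have "z \<bullet> z = 0"
      using symmetric_range_kernel_orthogonal [OF A y z] by (simp add: inner_add_right inner_commute)
    then show ?thesis using y eq by simp
  qed
  then show "H \<in> sym_on (range ((*v) A))"
    using H by (simp add: sym_on_def)
qed

text \<open>The quadratic form attains its minimum on the compact unit sphere of the range. The
  minimum is positive, because a zero would lie in both the range and the kernel. Homogeneity
  extends the bound to all of the range.\<close>

lemma psd_coercive_on_range:
  fixes A :: "real^'n^'n"
  assumes A: "psd A"
  obtains c where "c > 0" "\<And>x. x \<in> range ((*v) A) \<Longrightarrow> c * (x \<bullet> x) \<le> x \<bullet> (A *v x)"
proof -
  let ?R = "range ((*v) A)" and ?q = "\<lambda>x. x \<bullet> (A *v x)"
  define S where "S = {x \<in> ?R. norm x = 1}"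
  have tr: "transpose A = A" using A by (simp add: psd_def)
  have "\<exists>c>0. \<forall>x\<in>S. c \<le> ?q x"
  proof (cases "S = {}")
    case False
    have "S = ?R \<inter> sphere 0 1" by (auto simp: S_def)
    then have "compact S"
      using closed_subspace [OF subspace_range_matrix, of A] by (simp only: closed_Int_compact compact_sphere)
    then obtain x where x: "x \<in> S" and min: "\<And>y. y \<in> S \<Longrightarrow> ?q x \<le> ?q y"
      using continuous_attains_inf [OF _ False, of ?q]
        continuous_on_inner [OF continuous_on_id matrix_vector_mult_linear_continuous_on]
      by (metis id_apply)
    have "?q x \<noteq> 0"
    proof
      assume "?q x = 0"
      then have "x \<bullet> x = 0"
        using psd_kernel [OF A] symmetric_range_kernel_orthogonal [OF tr] x by (auto simp: S_def)
      then show False using x by (simp add: S_def)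
    qed
    moreover have "?q x \<ge> 0" using A by (simp add: psd_def)
    ultimately show ?thesis using min by (metis less_eq_real_def)
  \<comment> \<open>The sphere is empty only for the zero matrix; the bound is then vacuous and 1
    serves as the constant.\<close>
  qed (auto intro: exI [of _ 1])
  then obtain c where "c > 0" and c: "\<And>x. x \<in> S \<Longrightarrow> c \<le> ?q x" by blast
  moreover have "c * (x \<bullet> x) \<le> ?q x" if "x \<in> ?R" for x
  proof (cases "x = 0")
    case False
    have "(1 / norm x) *\<^sub>R x \<in> S"
      using that False subspace_scale [OF subspace_range_matrix] by (simp add: S_def)
    then have "c \<le> ?q ((1 / norm x) *\<^sub>R x)" by (rule c)
    also have "\<dots> = ?q x / (x \<bullet> x)"
      by (simp add: matrix_vector_mult_scaleR dot_square_norm power2_eq_square)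
    finally show ?thesis using False by (simp add: pos_le_divide_eq)
  qed simp
  ultimately show ?thesis using that by blast
qed

text \<open>Both \<open>A\<close> and \<open>H\<close> annihilate the kernel component of a vector,
  so only its range component contributes. There the form of \<open>A\<close> is coercive and
  dominates that of \<open>t *\<^sub>R H\<close> for small \<open>t\<close>, of either sign.\<close>

lemma psd_perturbation:
  fixes A H :: "real^'n^'n"
  assumes A: "psd A" and H: "H \<in> sym_on (range ((*v) A))"
  obtains e where "e > 0" "\<And>t. \<bar>t\<bar> \<le> e \<Longrightarrow> psd (A + t *\<^sub>R H)"
proof -
  have trA: "transpose A = A" using A by (simp add: psd_def)
  have trH: "transpose H = H" using H by (simp add: sym_on_def)
  obtain c where "c > 0" and c: "\<And>x. x \<in> range ((*v) A) \<Longrightarrow> c * (x \<bullet> x) \<le> x \<bullet> (A *v x)"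
    using psd_coercive_on_range [OF A] by metis
  define K where "K = onorm ((*v) H)"
  have K: "\<bar>x \<bullet> (H *v x)\<bar> \<le> K * (x \<bullet> x)" for x
  proof -
    have "\<bar>x \<bullet> (H *v x)\<bar> \<le> norm x * norm (H *v x)" by (rule Cauchy_Schwarz_ineq2)
    also have "\<dots> \<le> norm x * (K * norm x)"
      unfolding K_def by (intro mult_left_mono onorm) auto
    finally show ?thesis by (simp add: dot_square_norm power2_eq_square algebra_simps)
  qed
  have "K \<ge> 0" unfolding K_def by (rule onorm_pos_le) simp
  \<comment> \<open>The denominator \<open>K + 1\<close> instead of \<open>K\<close> covers
    \<open>K = 0\<close>.\<close>
  have "psd (A + t *\<^sub>R H)" if t: "\<bar>t\<bar> \<le> c / (K + 1)" for t
  proof -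
    have "transpose (A + t *\<^sub>R H) = A + t *\<^sub>R H"
      using trA trH by (simp add: transpose_def vec_eq_iff)
    moreover have "0 \<le> v \<bullet> ((A + t *\<^sub>R H) *v v)" for v
    proof -
      obtain y z where y: "y \<in> range ((*v) A)" and z: "A *v z = 0" and v: "v = y + z"
        by (rule symmetric_range_kernel_decomp [OF trA]) (rule that)
      have Hz: "H *v z = 0" using H z sym_on_range_iff [OF trA trH] by blast
      have "\<bar>t\<bar> * K \<le> \<bar>t\<bar> * (K + 1)" by (simp add: mult_left_mono)
      also have "\<dots> \<le> c" using t \<open>K \<ge> 0\<close> by (simp add: pos_le_divide_eq)
      finally have tK: "\<bar>t\<bar> * K \<le> c" .
      have "\<bar>t * (y \<bullet> (H *v y))\<bar> \<le> \<bar>t\<bar> * (K * (y \<bullet> y))"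
        unfolding abs_mult by (intro mult_left_mono K) simp
      also have "\<dots> \<le> c * (y \<bullet> y)"
        using mult_right_mono [OF tK, of "y \<bullet> y"] by (simp add: mult.assoc)
      also have "\<dots> \<le> y \<bullet> (A *v y)" using c [OF y] .
      finally have "0 \<le> y \<bullet> (A *v y) + t * (y \<bullet> (H *v y))" by linarith
      also have "\<dots> = v \<bullet> (A *v v) + t * (v \<bullet> (H *v v))"
        using z Hz inner_symmetric_matrix_vector [OF trA, of z y]
          inner_symmetric_matrix_vector [OF trH, of z y]
        by (simp add: v matrix_vector_right_distrib inner_add_left)
      also have "\<dots> = v \<bullet> ((A + t *\<^sub>R H) *v v)"
        by (simp add: matrix_vector_mult_add_rdistrib inner_add_right scaleR_matrix_vector_assoc [symmetric])
      finally show ?thesis .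
    qed
    ultimately show ?thesis by (simp add: psd_def)
  qed
  moreover have "c / (K + 1) > 0" using \<open>c > 0\<close> \<open>K \<ge> 0\<close> by simp
  ultimately show ?thesis using that by blast
qed

section \<open>Faces of the block elliptope\<close>

text \<open>For \<open>V\<close> the range of \<open>X\<close> and \<open>K = UNIV\<close> this is
  the direction space of the face at \<open>X\<close>; general \<open>K\<close> allows the diagonal
  blocks to be imposed one at a time.\<close>

definition block_tangent :: "(real^('m::finite \<times> 'd::finite)) set \<Rightarrow> 'm set \<Rightarrow> (real^('m \<times> 'd)^('m \<times> 'd)) set"
  where "block_tangent V K = {H \<in> sym_on V. \<forall>i\<in>K. block H i i = 0}"

lemma block_add: "block (A + B) i j = block A i j + block B i j"
  by (simp add: block_def vec_eq_iff)

lemma block_scaleR: "block (c *\<^sub>R A) i j = c *\<^sub>R block A i j"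
  by (simp add: block_def vec_eq_iff)

lemma linear_block: "linear (\<lambda>A. block A i j)"
  by (rule linearI) (simp_all add: block_add block_scaleR)

lemma subspace_block_tangent:
  assumes "subspace V"
  shows "subspace (block_tangent V K)"
  using subspace_sym_on [OF assms]
  by (simp add: block_tangent_def subspace_def block_add block_scaleR linear_0 [OF linear_block])

text \<open>\<open>F\<close> is a face: if a proper convex combination of two psd matrices kills v,
  both quadratic forms vanish at v, and \<open>psd_kernel\<close> applies. \<open>X\<close> is
  relatively interior because it can be moved a little both ways along every direction in
  \<open>L\<close>. Uniqueness identifies \<open>F\<close> with the face at \<open>X\<close>, and
  the differences from \<open>X\<close> span exactly \<open>L\<close>.\<close>

lemma face_at_block_elliptope:
  fixes X :: "real^('m::finite \<times> 'd::finite)^('m \<times> 'd)"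
  assumes X: "X \<in> block_elliptope"
  defines "F \<equiv> {Z \<in> block_elliptope. \<forall>v. X *v v = 0 \<longrightarrow> Z *v v = 0}"
    and "L \<equiv> block_tangent (range ((*v) X)) UNIV"
  shows "face_at block_elliptope X = F" and "aff_dim F = int (dim L)"
proof -
  have trX: "transpose X = X" and psdX: "psd X" using X by (auto simp: block_elliptope_def psd_def)
  have XF: "X \<in> F" using X by (simp add: F_def)
  have L: "subspace L"
    unfolding L_def by (intro subspace_block_tangent subspace_range_matrix)
  have diff: "Z - X \<in> L" if "Z \<in> F" for Z
  proof -
    have Z: "psd Z" "\<And>i. block Z i i = block X i i" "\<And>v. X *v v = 0 \<Longrightarrow> Z *v v = 0"
      using that X by (auto simp: F_def block_elliptope_def)
    have "transpose (Z - X) = Z - X"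
      using Z(1) trX by (simp add: psd_def transpose_def vec_eq_iff)
    then have "Z - X \<in> sym_on (range ((*v) X))"
      using Z(3) by (simp add: sym_on_range_iff [OF trX] matrix_vector_mult_diff_rdistrib)
    then show ?thesis
      using Z(2) by (simp add: L_def block_tangent_def linear_diff [OF linear_block])
  qed
  have perturb: "\<exists>e>0. \<forall>t. \<bar>t\<bar> \<le> e \<longrightarrow> X + t *\<^sub>R H \<in> F" if "H \<in> L" for H
  proof -
    have H: "H \<in> sym_on (range ((*v) X))" and bl: "\<And>i. block H i i = 0"
      using that by (auto simp: L_def block_tangent_def)
    from H have "transpose H = H" by (simp add: sym_on_def)
    then have ker: "X *v v = 0 \<longrightarrow> H *v v = 0" for v
      using sym_on_range_iff [OF trX] H by blast
    obtain e where "e > 0" and e: "\<And>t. \<bar>t\<bar> \<le> e \<Longrightarrow> psd (X + t *\<^sub>R H)"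
      using psd_perturbation [OF psdX H] by metis
    moreover have "X + t *\<^sub>R H \<in> F" if "\<bar>t\<bar> \<le> e" for t
      using e [OF that] X ker
      by (simp add: F_def block_elliptope_def block_add block_scaleR bl
          matrix_vector_mult_add_rdistrib scaleR_matrix_vector_assoc [symmetric])
    ultimately show ?thesis by blast
  qed
  have "convex F"
  proof (rule convexI)
    fix A B and u w :: real
    assume AB: "A \<in> F" "B \<in> F" and uw: "0 \<le> u" "0 \<le> w" "u + w = 1"
    then have "u *\<^sub>R A + w *\<^sub>R B \<in> block_elliptope"
      unfolding F_def by (intro convexD [OF convex_block_elliptope]) auto
    with AB show "u *\<^sub>R A + w *\<^sub>R B \<in> F"
      by (simp add: F_def matrix_vector_mult_add_rdistrib scaleR_matrix_vector_assoc [symmetric])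
  qed
  have "F face_of block_elliptope"
    unfolding face_of_def
  proof (intro conjI ballI impI)
    fix A B Z assume A: "A \<in> block_elliptope" and B: "B \<in> block_elliptope"
      and Z: "Z \<in> F" and seg: "Z \<in> open_segment A B"
    obtain u where u: "0 < u" "u < 1" "Z = (1 - u) *\<^sub>R A + u *\<^sub>R B"
      using seg by (auto simp: in_segment)
    have psd: "psd A" "psd B" using A B by (auto simp: block_elliptope_def)
    have "A *v v = 0 \<and> B *v v = 0" if "X *v v = 0" for v
    proof -
      have a: "0 \<le> (1 - u) * (v \<bullet> (A *v v))" and b: "0 \<le> u * (v \<bullet> (B *v v))"
        using psd u by (auto simp: psd_def)
      have "Z *v v = 0" using Z that by (simp add: F_def)
      then have "v \<bullet> (Z *v v) = 0" by simp
      then have "(1 - u) * (v \<bullet> (A *v v)) + u * (v \<bullet> (B *v v)) = 0"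
        by (simp add: u(3) matrix_vector_mult_add_rdistrib inner_add_right
            scaleR_matrix_vector_assoc [symmetric])
      with a b have "(1 - u) * (v \<bullet> (A *v v)) = 0" "u * (v \<bullet> (B *v v)) = 0" by linarith+
      then show ?thesis using u psd by (auto intro: psd_kernel)
    qed
    then show "A \<in> F" "B \<in> F" using A B by (auto simp: F_def)
  qed (use \<open>convex F\<close> in \<open>auto simp: F_def\<close>)
  moreover have "X \<in> rel_interior F"
  proof -
    \<comment> \<open>Criterion for a relatively interior point: every segment from a point of
      \<open>F\<close> to \<open>X\<close> can be prolonged beyond \<open>X\<close> within
      \<open>F\<close>.\<close>
    have "\<exists>e>1. (1 - e) *\<^sub>R Z + e *\<^sub>R X \<in> F" if "Z \<in> F" for Z
    proof -
      have "X - Z \<in> L"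
        using subspace_neg [OF L diff [OF that]] by simp
      then obtain e where "e > 0" "X + e *\<^sub>R (X - Z) \<in> F"
        using perturb by (metis abs_of_pos order_refl)
      then show ?thesis
        by (intro exI [of _ "1 + e"]) (simp add: algebra_simps)
    qed
    then show ?thesis using convex_rel_interior_iff [OF \<open>convex F\<close>] XF by blast
  qed
  ultimately show "face_at block_elliptope X = F"
    using ex1_face_at [OF convex_block_elliptope X] face_at_face_of [OF convex_block_elliptope X] by blast
  have "span ((+) (- X) ` F) = L"
  proof (rule antisym)
    show "span ((+) (- X) ` F) \<subseteq> L"
      using diff L by (intro span_minimal) auto
    show "L \<subseteq> span ((+) (- X) ` F)"
    proof
      fix H assume "H \<in> L"
      then obtain e where e: "e > 0" "X + e *\<^sub>R H \<in> F"
        using perturb by (metis abs_of_pos order_refl)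
      then have "e *\<^sub>R H \<in> span ((+) (- X) ` F)"
        by (intro span_base) (force intro: image_eqI [where x = "X + e *\<^sub>R H"])
      then have "(1 / e) *\<^sub>R (e *\<^sub>R H) \<in> span ((+) (- X) ` F)" by (rule span_scale)
      then show "H \<in> span ((+) (- X) ` F)" using e by simp
    qed
  qed
  then have "dim ((+) (- X) ` F) = dim L" by (metis dim_span)
  then show "aff_dim F = int (dim L)"
    using aff_dim_eq_dim [of X F] hull_inc [OF XF] by simp
qed

section \<open>Conditions imposed by the diagonal blocks\<close>

definition block_part :: "'m::finite \<Rightarrow> real^('m \<times> 'd::finite) \<Rightarrow> real^'d"
  where "block_part i v = (\<chi> a. v $ (i, a))"

lemma linear_block_part: "linear (block_part i)"
  by (rule linearI) (simp_all add: block_part_def vec_eq_iff)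

lemma block_symprod: "block (symprod x y) i i = symprod (block_part i x) (block_part i y)"
  by (simp add: block_def symprod_def block_part_def vec_eq_iff)

lemma transpose_block:
  "transpose A = A \<Longrightarrow> transpose (block A i i) = block A i i"
  by (simp add: transpose_def block_def vec_eq_iff)

text \<open>Since the diagonal block is the identity, \<open>X\<close> applied to a vector supported
  on block \<open>i\<close> reproduces that block. This supplies the surjectivity needed for the
  upper bound.\<close>

lemma block_part_range_block_elliptope:
  fixes X :: "real^('m::finite \<times> 'd::finite)^('m \<times> 'd)"
  assumes "X \<in> block_elliptope"
  shows "block_part i ` range ((*v) X) = UNIV"
proof -
  have "y \<in> block_part i ` range ((*v) X)" for y :: "real^'d"
  proof -
    define u :: "real^('m \<times> 'd)" where "u = (\<chi> q. if fst q = i then y $ snd q else 0)"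
    have "block_part i (X *v u) = block X i i *v y"
    proof -
      have "(\<Sum>q\<in>UNIV. X $ (i, a) $ q * u $ q) = (\<Sum>b\<in>UNIV. X $ (i, a) $ (i, b) * y $ b)" for a
      proof -
        have "(\<Sum>q\<in>UNIV. X $ (i, a) $ q * u $ q) = (\<Sum>q\<in>Pair i ` UNIV. X $ (i, a) $ q * u $ q)"
          by (rule sum.mono_neutral_right) (auto simp: u_def)
        also have "\<dots> = (\<Sum>b\<in>UNIV. X $ (i, a) $ (i, b) * y $ b)"
          by (simp add: u_def sum.reindex inj_on_def)
        finally show ?thesis .
      qed
      then show ?thesis
        by (simp add: block_part_def matrix_vector_mult_def block_def vec_eq_iff)
    qed
    also have "\<dots> = y" using assms by (simp add: block_elliptope_def)
    finally show ?thesis by blast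
  qed
  then show ?thesis by blast
qed

lemma block_tangent_insert:
  "block_tangent V (insert k K) = {H \<in> block_tangent V K. block H k k = 0}"
  by (auto simp: block_tangent_def)

text \<open>
  If \<open>w \<in> V\<close> vanishes on the blocks in \<open>K\<close>, then \<open>symprod w u\<close> is tangent for \<open>K\<close> for every
  \<open>u \<in> V\<close>; hence the \<open>k\<close>-th diagonal constraint removes at least \<open>r (d + 1) / 2\<close> dimensions,
  where \<open>r\<close> is the dimension lost by \<open>{v \<in> V. \<forall>i\<in>K. block_part i v = 0}\<close> when \<open>k\<close> joins \<open>K\<close>.
\<close>

lemma dim_block_tangent_le:
  fixes V :: "(real^('m::finite \<times> 'd::finite)) set"
  assumes V: "subspace V" and surj: "\<And>i. block_part i ` V = UNIV"
  shows "2 * dim (block_tangent V K) + (CARD('d) + 1) * dim V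
    \<le> dim V * (dim V + 1) + (CARD('d) + 1) * dim {v \<in> V. \<forall>i\<in>K. block_part i v = 0}"
proof -
  have "finite K" by simp
  then show ?thesis
  proof (induction K rule: finite_induct)
    case empty
    then show ?case using dim_sym_on [OF V] by (simp add: block_tangent_def)
  next
    case (insert k K)
    define N where "N K = {v \<in> V. \<forall>i\<in>K. block_part i v = 0}" for K
    \<comment> \<open>By rank-nullity, \<open>dim T\<close> is the number of dimensions lost when
      block \<open>k\<close> is imposed, and \<open>dim ?R\<close> is the number r lost by
      \<open>N K\<close>.\<close>
    define T where "T = (\<lambda>H. block H k k) ` block_tangent V K"
    let ?R = "block_part k ` N K"
    have N: "subspace (N K)"
      using V unfolding N_def subspace_def
      by (simp add: linear_0 [OF linear_block_part] linear_add [OF linear_block_part]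
          linear_cmul [OF linear_block_part])
    have R: "subspace ?R" by (rule linear_subspace_image [OF linear_block_part N])
    have "symprod x y \<in> T" if x: "x \<in> ?R" for x y
    proof -
      obtain w where w: "w \<in> N K" "x = block_part k w" using x by blast
      obtain u where u: "u \<in> V" "y = block_part k u" using surj by (metis UNIV_I imageE)
      have "symprod w u \<in> sym_on V"
        using w u V by (simp add: N_def symprod_in_sym_on)
      moreover have "block (symprod w u) i i = 0" if "i \<in> K" for i
        using w that by (simp add: block_symprod N_def) (simp add: symprod_def vec_eq_iff)
      ultimately have "symprod w u \<in> block_tangent V K" by (simp add: block_tangent_def)
      then show ?thesis
        unfolding T_def by (rule rev_image_eqI) (simp add: w u block_symprod)
    qed
    then have "dim ?R * (2 * CARD('d) + 1) \<le> 2 * dim T + dim ?R * dim ?R"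
      using dim_ge_symprods [OF R subspace_UNIV subset_UNIV, of T] by simp
    moreover have "dim ?R \<le> CARD('d)" using dim_subset_UNIV [of ?R] by simp
    \<comment> \<open>With d = r + s, the count r (2 d + 1) - r^2 equals r (d + 1) + r s; dropping r
      s leaves a bound linear in r, which can be summed over the blocks.\<close>
    then obtain s where "CARD('d) = dim ?R + s" using le_Suc_ex by blast
    ultimately have 1: "(CARD('d) + 1) * dim ?R \<le> 2 * dim T" by (simp add: algebra_simps)
    have "dim ?R + dim {v \<in> N K. block_part k v = 0} = dim (N K)"
      by (rule dim_image_plus_dim_kernel [OF linear_block_part N])
    moreover have "{v \<in> N K. block_part k v = 0} = N (insert k K)" by (auto simp: N_def)
    ultimately have 2: "dim (N K) = dim ?R + dim (N (insert k K))" by simp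
    have 3: "dim (block_tangent V K) = dim T + dim (block_tangent V (insert k K))"
      unfolding T_def block_tangent_insert
      using dim_image_plus_dim_kernel [OF linear_block subspace_block_tangent [OF V]] by metis
    have "2 * dim (block_tangent V K) + (CARD('d) + 1) * dim V
        \<le> dim V * (dim V + 1) + (CARD('d) + 1) * dim (N K)"
      using insert.IH by (simp add: N_def)
    then show ?case
      using 1 unfolding 2 3 N_def [symmetric] by (simp add: algebra_simps)
  qed
qed

text \<open>The values of one diagonal block are symmetric d by d matrices, so each block in
  \<open>K\<close> removes at most d (d + 1) / 2 dimensions from those of
  \<open>sym_on V\<close>.\<close>

lemma dim_block_tangent_ge:
  fixes V :: "(real^('m::finite \<times> 'd::finite)) set"
  assumes V: "subspace V"
  shows "dim V * (dim V + 1) \<le> 2 * dim (block_tangent V K) + card K * (CARD('d) * (CARD('d) + 1))"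
proof -
  have "finite K" by simp
  then show ?thesis
  proof (induction K rule: finite_induct)
    case empty
    then show ?case using dim_sym_on [OF V] by (simp add: block_tangent_def)
  next
    case (insert k K)
    let ?T = "(\<lambda>H. block H k k) ` block_tangent V K"
    have "?T \<subseteq> sym_on UNIV"
      by (auto simp: block_tangent_def sym_on_def transpose_block)
    then have "dim ?T \<le> dim (sym_on UNIV :: (real^'d^'d) set)" by (rule dim_subset)
    then have "2 * dim ?T \<le> CARD('d) * (CARD('d) + 1)"
      using dim_sym_on [OF subspace_UNIV, where 'n='d] by simp
    moreover have "dim (block_tangent V K) = dim ?T + dim (block_tangent V (insert k K))"
      unfolding block_tangent_insert
      using dim_image_plus_dim_kernel [OF linear_block subspace_block_tangent [OF V]] by metis
    ultimately show ?case using insert by (simp add: algebra_simps)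
  qed
qed

section \<open>Bounds on the dimension of a face\<close>

lemma aff_dim_face_at_le:
  fixes X :: "real^('m::finite \<times> 'd::finite)^('m \<times> 'd)"
  assumes X: "X \<in> block_elliptope"
  shows "2 * aff_dim (face_at block_elliptope X) + (int CARD('d) + 1) * int (rank X)
    \<le> int (rank X) * (int (rank X) + 1)"
proof -
  let ?V = "range ((*v) X)"
  \<comment> \<open>A vector vanishing on all blocks is zero, so the last term of the count for
    \<open>K = UNIV\<close> disappears.\<close>
  have "{v \<in> ?V. \<forall>i\<in>UNIV. block_part i v = 0} \<subseteq> {0}"
    by (auto simp: block_part_def vec_eq_iff)
  then have zero: "dim {v \<in> ?V. \<forall>i\<in>UNIV. block_part i v = 0} = 0"
    by (simp only: dim_eq_0)
  have "2 * dim (block_tangent ?V UNIV) + (CARD('d) + 1) * rank X \<le> rank X * (rank X + 1)"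
    using dim_block_tangent_le [OF subspace_range_matrix block_part_range_block_elliptope [OF X], of UNIV]
    unfolding zero rank_dim_range by simp
  then have "int (2 * dim (block_tangent ?V UNIV) + (CARD('d) + 1) * rank X) \<le> int (rank X * (rank X + 1))"
    by (simp only: zle_int)
  then show ?thesis
    using face_at_block_elliptope [OF X] by (simp add: algebra_simps)
qed

text \<open>If the blocks in \<open>K\<close> already imply the others, only they are charged.
  \<open>K = UNIV\<close> gives the general lower bound; a \<open>K\<close> with p / d elements
  gives a bound that meets the upper one.\<close>

lemma aff_dim_face_at_ge:
  fixes X :: "real^('m::finite \<times> 'd::finite)^('m \<times> 'd)"
  assumes X: "X \<in> block_elliptope"
    and K: "block_tangent (range ((*v) X)) K \<subseteq> block_tangent (range ((*v) X)) UNIV"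
  shows "int (rank X) * (int (rank X) + 1)
    \<le> 2 * aff_dim (face_at block_elliptope X) + int (card K) * (int CARD('d) * (int CARD('d) + 1))"
proof -
  let ?V = "range ((*v) X)"
  have "dim (block_tangent ?V K) \<le> dim (block_tangent ?V UNIV)"
    by (rule dim_subset [OF K])
  then have "rank X * (rank X + 1) \<le> 2 * dim (block_tangent ?V UNIV) + card K * (CARD('d) * (CARD('d) + 1))"
    using dim_block_tangent_ge [OF subspace_range_matrix, of X K] by (simp add: rank_dim_range)
  then have "int (rank X * (rank X + 1))
      \<le> int (2 * dim (block_tangent ?V UNIV) + card K * (CARD('d) * (CARD('d) + 1)))"
    by (simp only: zle_int)
  then show ?thesis
    using face_at_block_elliptope [OF X] by (simp add: algebra_simps)
qed

section \<open>Matrices of maximal face dimension\<close>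

definition fibre_matrix :: "('n \<Rightarrow> 'n) \<Rightarrow> real^'n^'n"
  where "fibre_matrix g = (\<chi> p q. if g p = g q then 1 else 0)"

lemma psd_fibre_matrix: "psd (fibre_matrix g)" for g :: "'n::finite \<Rightarrow> 'n"
proof -
  \<comment> \<open>Row \<open>p\<close> of \<open>Y\<close> is the standard basis vector of index
    \<open>g p\<close>, so the fibre matrix is the Gram matrix of these rows.\<close>
  define Y :: "real^'n^'n" where "Y = (\<chi> p q. if q = g p then 1 else 0)"
  have "fibre_matrix g = Y ** transpose Y"
    by (simp add: fibre_matrix_def Y_def matrix_matrix_mult_def transpose_def vec_eq_iff
        if_distrib [where f = "\<lambda>x. x * _"] cong: if_cong)
  moreover have "v \<bullet> ((Y ** transpose Y) *v v) = (transpose Y *v v) \<bullet> (transpose Y *v v)" for v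
    by (metis dot_lmul_matrix matrix_vector_mul_assoc transpose_matrix_vector)
  ultimately show ?thesis
    by (simp add: psd_def matrix_transpose_mul)
qed

text \<open>The distinct columns are the indicator vectors of the nonempty fibres of
  \<open>g\<close>, which have disjoint supports and are therefore independent.\<close>

lemma rank_fibre_matrix: "rank (fibre_matrix g) = card (range g)" for g :: "'n::finite \<Rightarrow> 'n"
proof -
  define w :: "'n \<Rightarrow> real^'n" where "w c = (\<chi> p. if g p = c then 1 else 0)" for c
  have "columns (fibre_matrix g) = w ` range g"
    by (auto simp: columns_def column_def fibre_matrix_def w_def)
  have orth: "w c \<bullet> w c' = 0" if "c \<noteq> c'" for c c'
    using that by (auto simp: w_def inner_vec_def intro!: sum.neutral)
  have nz: "w c \<noteq> 0" if "c \<in> range g" for c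
    using that by (auto simp: w_def vec_eq_iff)
  have "inj_on w (range g)"
    by (rule inj_onI) (metis orth nz inner_eq_zero_iff)
  moreover have "independent (w ` range g)"
  proof (rule pairwise_orthogonal_independent)
    show "pairwise orthogonal (w ` range g)"
      unfolding pairwise_def orthogonal_def using orth by (metis imageE)
    show "0 \<notin> w ` range g" using nz by (metis imageE)
  qed
  ultimately show ?thesis
    by (simp add: column_rank_def \<open>columns _ = _\<close> dim_eq_card_independent card_image)
qed

lemma range_fibre_matrix:
  fixes g :: "'n::finite \<Rightarrow> 'n"
  assumes "v \<in> range ((*v) (fibre_matrix g))" "g p = g q"
  shows "v $ p = v $ q"
  using assms by (auto simp: fibre_matrix_def matrix_vector_mult_def)

text \<open>Vectors in the range are constant on the fibres of \<open>g\<close>. This applies to the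
  columns of \<open>H\<close>, and by symmetry to its rows.\<close>

lemma sym_on_range_fibre_matrix:
  fixes g :: "'n::finite \<Rightarrow> 'n"
  assumes H: "H \<in> sym_on (range ((*v) (fibre_matrix g)))" and "g p = g p'" "g q = g q'"
  shows "H $ p $ q = H $ p' $ q'"
proof -
  have row: "H $ r $ s = H $ r' $ s" if "g r = g r'" for r r' s
  proof -
    have "H *v axis s 1 \<in> range ((*v) (fibre_matrix g))"
      using H by (simp add: sym_on_def)
    then show ?thesis
      using range_fibre_matrix [of "H *v axis s 1" g r r'] that
      by (simp add: matrix_vector_mult_basis column_def)
  qed
  have sym: "H $ r $ s = H $ s $ r" for r s
    using H by (simp add: sym_on_def transpose_def vec_eq_iff)
  show ?thesis
    using row [OF \<open>g p = g p'\<close>] row [OF \<open>g q = g q'\<close>] sym by metis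
qed

text \<open>A retraction \<open>f\<close> of the block indices onto \<open>K\<close> makes each
  block outside \<open>K\<close> a copy of block \<open>c\<close>. Diagonal block \<open>i\<close>
  of a tangent matrix then equals block \<open>f i\<close>, so the blocks in \<open>K\<close>
  control all others.\<close>

lemma ex_block_elliptope_repeated_blocks:
  fixes K :: "'m::finite set"
  assumes "K \<noteq> {}"
  shows "\<exists>X \<in> (block_elliptope :: (real^('m \<times> 'd::finite)^('m \<times> 'd)) set).
    rank X = card K * CARD('d) \<and>
    block_tangent (range ((*v) X)) K \<subseteq> block_tangent (range ((*v) X)) UNIV"
proof -
  obtain c where "c \<in> K" using assms by blast
  define f where "f i = (if i \<in> K then i else c)" for i
  have fK: "f i \<in> K" and ff: "f (f i) = f i" for i
    using \<open>c \<in> K\<close> by (auto simp: f_def)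
  have "f ` UNIV = K" using fK by (auto simp: image_iff) (metis f_def)
  \<comment> \<open>The index within a block is kept, so that distinct rows of the same block stay
    orthogonal and the diagonal blocks are identities.\<close>
  define g :: "'m \<times> 'd \<Rightarrow> 'm \<times> 'd" where "g = (\<lambda>(i, a). (f i, a))"
  let ?X = "fibre_matrix g"
  have "block ?X i i = mat 1" for i
    by (simp add: block_def fibre_matrix_def g_def mat_def vec_eq_iff)
  then have "?X \<in> block_elliptope"
    by (simp add: block_elliptope_def psd_fibre_matrix)
  moreover have "range g = K \<times> UNIV"
    using \<open>f ` UNIV = K\<close> by (force simp: g_def)
  then have "rank ?X = card K * CARD('d)"
    by (simp add: rank_fibre_matrix card_cartesian_product)
  moreover have "block_tangent (range ((*v) ?X)) K \<subseteq> block_tangent (range ((*v) ?X)) UNIV"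
  proof
    fix H assume H: "H \<in> block_tangent (range ((*v) ?X)) K"
    have "block H i i = block H (f i) (f i)" for i
      using H unfolding block_def block_tangent_def
      by (auto simp: g_def ff vec_eq_iff intro: sym_on_range_fibre_matrix)
    then show "H \<in> block_tangent (range ((*v) ?X)) UNIV"
      using H fK by (simp add: block_tangent_def)
  qed
  ultimately show ?thesis by blast
qed

theorem theorem3p15:
  fixes p :: nat
  assumes "CARD('d::finite) \<le> p" and "p \<le> CARD('m::finite) * CARD('d)"
  shows "(\<forall>X \<in> (block_elliptope :: (real^('m \<times> 'd)^('m \<times> 'd)) set). rank X = p \<longrightarrow>
            real p * (real p + 1) / 2 - real (CARD('m) * CARD('d)) * ((real CARD('d) + 1) / 2)
              \<le> real_of_int (aff_dim (face_at block_elliptope X)) \<and>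
            real_of_int (aff_dim (face_at block_elliptope X))
              \<le> real p * (real p + 1) / 2 - real p * ((real CARD('d) + 1) / 2)) \<and>
         (CARD('d) dvd p \<longrightarrow>
            (\<exists>X \<in> (block_elliptope :: (real^('m \<times> 'd)^('m \<times> 'd)) set). rank X = p \<and>
              real_of_int (aff_dim (face_at block_elliptope X))
                = real p * (real p + 1) / 2 - real p * ((real CARD('d) + 1) / 2)))"
proof (intro conjI ballI impI)
  have upper: "real_of_int (aff_dim (face_at block_elliptope X))
      \<le> real (rank X) * (real (rank X) + 1) / 2 - real (rank X) * ((real CARD('d) + 1) / 2)"
    if "X \<in> block_elliptope" for X :: "real^('m \<times> 'd)^('m \<times> 'd)"
  proof -
    have "real_of_int (2 * aff_dim (face_at block_elliptope X) + (int CARD('d) + 1) * int (rank X))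
        \<le> real_of_int (int (rank X) * (int (rank X) + 1))"
      using aff_dim_face_at_le [OF that] by (simp only: of_int_le_iff)
    then show ?thesis by (simp add: field_simps)
  qed
  have lower: "real (rank X) * (real (rank X) + 1) / 2 - real (card K * CARD('d)) * ((real CARD('d) + 1) / 2)
      \<le> real_of_int (aff_dim (face_at block_elliptope X))"
    if "X \<in> block_elliptope" "block_tangent (range ((*v) X)) K \<subseteq> block_tangent (range ((*v) X)) UNIV"
    for X :: "real^('m \<times> 'd)^('m \<times> 'd)" and K
  proof -
    have "real_of_int (int (rank X) * (int (rank X) + 1))
        \<le> real_of_int (2 * aff_dim (face_at block_elliptope X)
            + int (card K) * (int CARD('d) * (int CARD('d) + 1)))"
      using aff_dim_face_at_ge [OF that] by (simp only: of_int_le_iff)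
    then show ?thesis by (simp add: field_simps)
  qed
  fix X :: "real^('m \<times> 'd)^('m \<times> 'd)"
  assume X: "X \<in> block_elliptope" and rank: "rank X = p"
  show "real p * (real p + 1) / 2 - real (CARD('m) * CARD('d)) * ((real CARD('d) + 1) / 2)
      \<le> real_of_int (aff_dim (face_at block_elliptope X))"
    using lower [OF X subset_refl] by (simp only: rank)
  show "real_of_int (aff_dim (face_at block_elliptope X))
      \<le> real p * (real p + 1) / 2 - real p * ((real CARD('d) + 1) / 2)"
    using upper [OF X] by (simp only: rank)
next
  assume "CARD('d) dvd p"
  then obtain k where k: "p = k * CARD('d)" by (metis dvd_def mult.commute)
  \<comment> \<open>The bound on \<open>p\<close> by the matrix size leaves room for
    \<open>k\<close> different blocks; below, \<open>CARD('d) \<le> p\<close> makes \<open>K\<close>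
    nonempty.\<close>
  have "k \<le> CARD('m)" using assms(2) by (simp add: k)
  then obtain K :: "'m set" where K: "card K = k"
    using obtain_subset_with_card_n [of k UNIV] by metis
  have "k \<noteq> 0" using assms(1) by (auto simp: k)
  then have "K \<noteq> {}" using K by auto
  from ex_block_elliptope_repeated_blocks [OF this, where 'd='d]
  obtain X :: "real^('m \<times> 'd)^('m \<times> 'd)"
    where X: "X \<in> block_elliptope" and rank: "rank X = p"
      and KU: "block_tangent (range ((*v) X)) K \<subseteq> block_tangent (range ((*v) X)) UNIV"
    by (auto simp: K k)
  have "real_of_int (2 * aff_dim (face_at block_elliptope X) + (int CARD('d) + 1) * int p)
      \<le> real_of_int (int p * (int p + 1))"
    using aff_dim_face_at_le [OF X] by (simp only: of_int_le_iff rank)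
  \<comment> \<open>Here \<open>card K * CARD('d) = p\<close>, so the lower bound coincides with the
    upper one.\<close>
  moreover have "real_of_int (int p * (int p + 1))
      \<le> real_of_int (2 * aff_dim (face_at block_elliptope X) + int p * (int CARD('d) + 1))"
    using aff_dim_face_at_ge [OF X KU] by (simp only: of_int_le_iff rank) (simp add: K k algebra_simps)
  ultimately have "real_of_int (aff_dim (face_at block_elliptope X))
      = real p * (real p + 1) / 2 - real p * ((real CARD('d) + 1) / 2)"
    by (simp add: field_simps)
  with X rank show "\<exists>X \<in> (block_elliptope :: (real^('m \<times> 'd)^('m \<times> 'd)) set). rank X = p \<and>
      real_of_int (aff_dim (face_at block_elliptope X))
        = real p * (real p + 1) / 2 - real p * ((real CARD('d) + 1) / 2)"
    by blast
qed

end
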